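(* Let $X$ and $Y$ be topological spaces equipped with (Baire measurable) scalings $T^X$ and $T^Y$ and with topologically and scaling consistent ideals $\mathcal{X}$ and $\mathcal{Y}$, respectively. Let $\psi:X\to Y$ be a continuous bornologically consistent morphism, that is, $\psi$ is continuous, $\psi^{-1}(B)\in\mathcal{X}$ for all $B\in\mathcal{Y}$, and $\psi(T^X_tx)=T^Y_t\psi(x)$ for all $x\in X$, $t>0$. Let $\nu$ be a Baire measure on $X$ such that $\nu\in\mathrm{RV}(X,T^X,\mathcal{X},g,\mu)$. If there exists $B\in\mathcal{Y}$ such that $\psi\mu(B)\in(0,\infty)$, then $\psi\nu\in\mathrm{RV}(Y,T^Y,\mathcal{Y},g,\psi\mu)$, where $\psi\nu$ and $\psi\mu$ denote the pushforwards of $\nu$ and $\mu$ under $\psi$.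
   Context: The Baire $\sigma$-algebra $\mathcal{B}a(X)$ is the smallest $\sigma$-algebra making all continuous functions $X\to\mathbb{R}$ measurable; Baire measures are measures on it with values in $[0,\infty]$. Functionally closed sets are zero sets $f^{-1}(\{0\})$ of continuous real functions $f$; functionally open sets are their complements. A scaling is a family of maps $T_t:X\to X$, $t>0$, with $T_tT_sx=T_{ts}x$, $T_1x=x$ and $(x,t)\mapsto T_tx$ being $\mathcal{B}a(X)\otimes\mathcal{B}((0,\infty))/\mathcal{B}a(X)$-measurable. An ideal $\mathcal{S}$ on $X$ is a family of subsets closed under finite unions and under taking subsets; $U_{\mathcal{S}}$ is the union of all its members. It is scaling consistent if $B\in\mathcal{S}$, $t>0$ imply $T_tB\in\mathcal{S}$. It is topologically consistent if each $B\in\mathcal{S}$ is contained in a functionally closed member of $\mathcal{S}$, and each $x\in U_{\mathcal{S}}$ has a functionally open neighbourhood belonging to $\mathcal{S}$. $M_\sigma(\mathcal{S})$ is the family of Baire measures $\mu$ on $X$ that are finite on all Baire sets in $\mathcal{S}$ and vanish on the complement of $U_{\mathcal{S}}$. $C(X,\mathcal{S})$ is the family of bounded continuous $f:U_{\mathcal{S}}\to\mathbb{R}$ whose support (closure in $X$ of $\{f\ne0\}$) belongs to $\mathcal{S}$; such $f$ is extended by zero to $X$. Regular variation: for a Baire measure $\nu$, $\nu\in\mathrm{RV}(X,T,\mathcal{S},g,\mu)$ means that $g:[0,\infty)\to[0,\infty)$ is measurable, $g(t)\to\infty$ as $t\to\infty$, $\mu\in M_\sigma(\mathcal{S})$ is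 non-trivial ($\mu(B)>0$ for some $B\in\mathcal{S}$), and $g(t)T_{t^{-1}}\nu\to\mu$ vaguely on $\mathcal{S}$, i.e. $g(t)\int f(T_{t^{-1}}x)\,\nu(dx)\to\int f\,d\mu$ as $t\to\infty$ for all $f\in C(X,\mathcal{S})$. Here $(T_{t^{-1}}\nu)(B)=\nu(T_tB)$. Convention: tail measures and their pushforwards are considered only on sets of the relevant ideal; thus $\psi\mu$ is viewed as an element of $M_\sigma(\mathcal{Y})$ by restricting it to $U_{\mathcal{Y}}$. *)

theory Defs
  imports "HOL-Analysis.Analysis"
begin

definition baire :: "'a::topological_space measure" where
  "baire = sigma UNIV {f -` B | (f :: 'a \<Rightarrow> real) B. continuous_on UNIV f \<and> B \<in> sets borel}"

definition baire_measure :: "'a::topological_space measure \<Rightarrow> bool" where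
  "baire_measure \<mu> \<longleftrightarrow> sets \<mu> = sets baire"

definition functionally_closed :: "'a::topological_space set \<Rightarrow> bool" where
  "functionally_closed A \<longleftrightarrow> (\<exists>f :: 'a \<Rightarrow> real. continuous_on UNIV f \<and> A = f -` {0})"

definition functionally_open :: "'a::topological_space set \<Rightarrow> bool" where
  "functionally_open A \<longleftrightarrow> functionally_closed (- A)"

text \<open>The values \<open>T t\<close> for \<open>t \<le> 0\<close> are irrelevant junk.\<close>

definition scaling :: "(real \<Rightarrow> 'a::topological_space \<Rightarrow> 'a) \<Rightarrow> bool" where
  "scaling T \<longleftrightarrow>
     (\<forall>t>0. \<forall>s>0. \<forall>x. T t (T s x) = T (t * s) x) \<and>
     (\<forall>x. T 1 x = x) \<and>
     (\<lambda>(x, t). T t x) \<in> measurable (baire \<Otimes>\<^sub>M restrict_space borel {0<..}) baire"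

definition ideal :: "'a set set \<Rightarrow> bool" where
  "ideal \<S> \<longleftrightarrow>
     (\<forall>\<F>. finite \<F> \<and> \<F> \<subseteq> \<S> \<longrightarrow> \<Union>\<F> \<in> \<S>) \<and>
     (\<forall>A B. B \<in> \<S> \<and> A \<subseteq> B \<longrightarrow> A \<in> \<S>)"

definition scaling_consistent :: "(real \<Rightarrow> 'a \<Rightarrow> 'a) \<Rightarrow> 'a set set \<Rightarrow> bool" where
  "scaling_consistent T \<S> \<longleftrightarrow> (\<forall>B\<in>\<S>. \<forall>t>0. T t ` B \<in> \<S>)"

definition topologically_consistent :: "'a::topological_space set set \<Rightarrow> bool" where
  "topologically_consistent \<S> \<longleftrightarrow>
     (\<forall>B\<in>\<S>. \<exists>C\<in>\<S>. functionally_closed C \<and> B \<subseteq> C) \<and>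
     (\<forall>x\<in>\<Union>\<S>. \<exists>V\<in>\<S>. functionally_open V \<and> x \<in> V)"

text \<open>
  The set \<open>\<Union>\<S>\<close> is open for a topologically consistent ideal, but it need not be a Baire set.
  That a measure vanishes on the complement of \<open>\<Union>\<S>\<close> therefore means that every Baire subset of
  the complement is a null set; if \<open>\<Union>\<S>\<close> is Baire, this says that the complement is null.
\<close>

definition M_sigma :: "'a::topological_space set set \<Rightarrow> 'a measure set" where
  "M_sigma \<S> = {\<mu>. baire_measure \<mu> \<and>
     (\<forall>B \<in> \<S> \<inter> sets baire. emeasure \<mu> B < \<infinity>) \<and>
     (\<forall>A \<in> sets baire. A \<subseteq> - \<Union>\<S> \<longrightarrow> emeasure \<mu> A = 0)}"

text \<open>
  The restriction of a Baire measure to \<open>\<Union>\<S>\<close>, again as a Baire measure on the whole space.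
  The value on \<open>A\<close> is \<open>\<mu> (A \<inter> \<Union>\<S>)\<close> if \<open>\<Union>\<S>\<close> is Baire; in general this is replaced by the inner
  approximation by Baire subsets of \<open>\<Union>\<S>\<close>, which is still a measure and agrees with \<open>\<mu>\<close> on all
  Baire subsets of \<open>\<Union>\<S>\<close>, see the three lemmas below.
\<close>

definition restrict_to_ideal :: "'a::topological_space set set \<Rightarrow> 'a measure \<Rightarrow> 'a measure" where
  "restrict_to_ideal \<S> \<mu> = measure_of UNIV (sets baire)
     (\<lambda>A. SUP C \<in> {C \<in> sets baire. C \<subseteq> \<Union>\<S>}. emeasure \<mu> (A \<inter> C))"

text \<open>Functions on \<open>\<Union>\<S>\<close> are represented by their extensions by zero.\<close>

definition C_ideal :: "'a::topological_space set set \<Rightarrow> ('a \<Rightarrow> real) set" where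
  "C_ideal \<S> = {f. continuous_on (\<Union>\<S>) f \<and> bounded (f ` \<Union>\<S>) \<and>
     (\<forall>x. x \<notin> \<Union>\<S> \<longrightarrow> f x = 0) \<and> closure {x. f x \<noteq> 0} \<in> \<S>}"

text \<open>
  An arbitrary Baire measure \<open>\<nu>\<close> may give infinite mass to sets \<open>T t B\<close> with \<open>B \<in> \<S>\<close>. As the
  Bochner integral of a non-integrable function is \<open>0\<close>, the convergence of the integrals to a
  finite limit has to include their finiteness for all large \<open>t\<close>.
\<close>

definition RV :: "(real \<Rightarrow> 'a::topological_space \<Rightarrow> 'a) \<Rightarrow> 'a set set \<Rightarrow> (real \<Rightarrow> real) \<Rightarrow>
    'a measure \<Rightarrow> 'a measure set" where
  "RV T \<S> g \<mu> = {\<nu>. baire_measure \<nu> \<and>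
     g \<in> borel_measurable (restrict_space borel {0..}) \<and>
     (\<forall>t\<ge>0. g t \<ge> 0) \<and>
     filterlim g at_top at_top \<and>
     \<mu> \<in> M_sigma \<S> \<and>
     (\<exists>B \<in> \<S> \<inter> sets baire. emeasure \<mu> B > 0) \<and>
     (\<forall>f \<in> C_ideal \<S>.
        (\<forall>\<^sub>F t in at_top. integrable \<nu> (\<lambda>x. f (T (inverse t) x))) \<and>
        ((\<lambda>t. g t * (\<integral>x. f (T (inverse t) x) \<partial>\<nu>)) \<longlongrightarrow> (\<integral>x. f x \<partial>\<mu>)) at_top)}"

definition bornologically_consistent_morphism ::
  "(real \<Rightarrow> 'a \<Rightarrow> 'a) \<Rightarrow> 'a set set \<Rightarrow> (real \<Rightarrow> 'b \<Rightarrow> 'b) \<Rightarrow> 'b set set \<Rightarrow> ('a \<Rightarrow> 'b) \<Rightarrow> bool" where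
  "bornologically_consistent_morphism TX \<X> TY \<Y> \<psi> \<longleftrightarrow>
     (\<forall>B\<in>\<Y>. \<psi> -` B \<in> \<X>) \<and> (\<forall>x. \<forall>t>0. \<psi> (TX t x) = TY t (\<psi> x))"

lemma space_baire [simp]: "space baire = UNIV"
  unfolding baire_def by (simp add: space_measure_of_conv)

lemma sets_restrict_to_ideal [simp]: "sets (restrict_to_ideal \<S> \<mu>) = sets baire"
proof -
  have "sigma_sets UNIV (sets (baire :: 'a measure)) = sets baire"
    using sets.sigma_sets_eq[of "baire :: 'a measure"] by simp
  then show ?thesis
    unfolding restrict_to_ideal_def by (subst sets_measure_of) auto
qed

lemma emeasure_restrict_to_ideal:
  fixes \<mu> :: "'a::topological_space measure"
  assumes \<mu>: "baire_measure \<mu>" and A: "A \<in> sets baire"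
  shows "emeasure (restrict_to_ideal \<S> \<mu>) A =
    (SUP C \<in> {C \<in> sets baire. C \<subseteq> \<Union>\<S>}. emeasure \<mu> (A \<inter> C))"
proof -
  define D where "D = {C \<in> sets (baire :: 'a measure). C \<subseteq> \<Union>\<S>}"
  have s: "sets \<mu> = sets baire" using \<mu> by (simp add: baire_measure_def)
  have Dne: "D \<noteq> {}" unfolding D_def by (force intro: exI[of _ "{}"])
  have DU: "C \<union> C' \<in> D" if "C \<in> D" "C' \<in> D" for C C'
    using that by (auto simp: D_def)
  have ca: "countably_additive (sets baire) (\<lambda>A. SUP C\<in>D. emeasure \<mu> (A \<inter> C))"
    unfolding countably_additive_def
  proof (intro allI impI)
    fix F :: "nat \<Rightarrow> 'a set"
    assume F: "range F \<subseteq> sets baire" "disjoint_family F"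
    have "(\<Sum>i. SUP C\<in>D. emeasure \<mu> (F i \<inter> C)) = (SUP C\<in>D. \<Sum>i. emeasure \<mu> (F i \<inter> C))"
    proof (rule ennreal_suminf_SUP_eq_directed)
      fix N and C C' :: "'a set" assume C: "C \<in> D" "C' \<in> D" and "finite (N :: nat set)"
      have "emeasure \<mu> (F n \<inter> C) \<le> emeasure \<mu> (F n \<inter> (C \<union> C'))"
        "emeasure \<mu> (F n \<inter> C') \<le> emeasure \<mu> (F n \<inter> (C \<union> C'))" for n
        using C F(1) by (auto intro!: emeasure_mono simp: s D_def)
      then show "\<exists>l\<in>D. \<forall>n\<in>N. emeasure \<mu> (F n \<inter> C) \<le> emeasure \<mu> (F n \<inter> l) \<and>
          emeasure \<mu> (F n \<inter> C') \<le> emeasure \<mu> (F n \<inter> l)"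
        using DU[OF C] by blast
    qed
    also have "\<dots> = (SUP C\<in>D. emeasure \<mu> (\<Union>(range F) \<inter> C))"
    proof (rule SUP_cong[OF refl])
      fix C assume "C \<in> D"
      then have "(\<Sum>i. emeasure \<mu> (F i \<inter> C)) = emeasure \<mu> (\<Union>i. F i \<inter> C)"
        using F by (intro suminf_emeasure) (auto simp: s D_def disjoint_family_on_def)
      then show "(\<Sum>i. emeasure \<mu> (F i \<inter> C)) = emeasure \<mu> (\<Union>(range F) \<inter> C)"
        by simp
    qed
    finally show "(\<Sum>i. SUP C\<in>D. emeasure \<mu> (F i \<inter> C)) =
        (SUP C\<in>D. emeasure \<mu> (\<Union>(range F) \<inter> C))" .
  qed
  have "positive (sets (baire :: 'a measure)) (\<lambda>A. SUP C\<in>D. emeasure \<mu> (A \<inter> C))"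
    using Dne by (simp add: positive_def)
  then show ?thesis
    using ca A sets.space_closed[of "baire :: 'a measure"]
    by (subst emeasure_measure_of[OF restrict_to_ideal_def]) (auto simp: D_def)
qed

lemma emeasure_restrict_to_ideal_subset:
  assumes \<mu>: "baire_measure \<mu>" and A: "A \<in> sets baire" and "A \<subseteq> \<Union>\<S>"
  shows "emeasure (restrict_to_ideal \<S> \<mu>) A = emeasure \<mu> A"
  unfolding emeasure_restrict_to_ideal[OF \<mu> A]
proof (rule antisym)
  show "(SUP C \<in> {C \<in> sets baire. C \<subseteq> \<Union>\<S>}. emeasure \<mu> (A \<inter> C)) \<le> emeasure \<mu> A"
    using \<mu> A by (intro SUP_least emeasure_mono) (auto simp: baire_measure_def)
  show "emeasure \<mu> A \<le> (SUP C \<in> {C \<in> sets baire. C \<subseteq> \<Union>\<S>}. emeasure \<mu> (A \<inter> C))"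
    using assms by (intro SUP_upper2[of A]) auto
qed

lemma emeasure_restrict_to_ideal_Baire:
  assumes \<mu>: "baire_measure \<mu>" and A: "A \<in> sets baire" and U: "\<Union>\<S> \<in> sets baire"
  shows "emeasure (restrict_to_ideal \<S> \<mu>) A = emeasure \<mu> (A \<inter> \<Union>\<S>)"
  unfolding emeasure_restrict_to_ideal[OF \<mu> A]
proof (rule antisym)
  show "(SUP C \<in> {C \<in> sets baire. C \<subseteq> \<Union>\<S>}. emeasure \<mu> (A \<inter> C)) \<le> emeasure \<mu> (A \<inter> \<Union>\<S>)"
    using \<mu> A U by (intro SUP_least emeasure_mono) (auto simp: baire_measure_def)
  show "emeasure \<mu> (A \<inter> \<Union>\<S>) \<le> (SUP C \<in> {C \<in> sets baire. C \<subseteq> \<Union>\<S>}. emeasure \<mu> (A \<inter> C))"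
    using U by (intro SUP_upper2[of "\<Union>\<S>"]) auto
qed

end

theory Submission
  imports Defs
begin

text \<open>
  The change of variables formula turns both sides of the vague convergence on \<open>\<Y>\<close> into
  integrals over \<open>X\<close>. For \<open>f \<in> C(Y, \<Y>)\<close> equivariance of \<open>\<psi>\<close> gives
  \<open>\<integral> f (TY s y) d\<psi>\<nu> = \<integral> (f \<circ> \<psi>) (TX s x) d\<nu>\<close> for \<open>s > 0\<close>, so the claim for \<open>f\<close> is the hypothesis for
  \<open>f \<circ> \<psi>\<close>, provided that \<open>f \<circ> \<psi>\<close> is again a test function, now for \<open>\<X>\<close>. This is where the
  other two properties of \<open>\<psi>\<close> enter: continuity keeps the support of \<open>f \<circ> \<psi>\<close> inside the preimage of the
  support of \<open>f\<close>, and bornological consistency puts this preimage into \<open>\<X>\<close>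
  (lemma \<open>C_ideal_compose\<close>).

  The limit is an integral over the restriction of \<open>\<psi>\<mu>\<close> to \<open>\<Union>\<Y>\<close> rather than over \<open>\<psi>\<mu>\<close> itself.
  The two measures coincide on Baire subsets of \<open>\<Union>\<Y>\<close>, and \<open>{f \<noteq> 0}\<close> is one, so no test function
  sees the difference (lemma \<open>integral_restrict_to_ideal\<close>). Local finiteness of the limit is again
  bornological consistency, and its non-triviality is the assumption on the existence of a set of
  positive finite mass.
\<close>

lemma continuous_imp_borel_measurable_baire:
  fixes f :: "'a::topological_space \<Rightarrow> real"
  assumes "continuous_on UNIV f"
  shows "f \<in> borel_measurable baire"
proof (rule measurableI)
  fix B :: "real set" assume "B \<in> sets borel"
  then show "f -` B \<inter> space baire \<in> sets baire"
    using assms unfolding baire_def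
    by (auto simp: sets_measure_of_conv space_measure_of_conv intro!: sigma_sets.Basic)
qed simp

lemma continuous_imp_measurable_baire:
  fixes \<psi> :: "'a::topological_space \<Rightarrow> 'b::topological_space"
  assumes "continuous_on UNIV \<psi>"
  shows "\<psi> \<in> measurable baire baire"
proof -
  have "\<psi> \<in> measurable baire
    (sigma UNIV {f -` B | (f :: 'b \<Rightarrow> real) B. continuous_on UNIV f \<and> B \<in> sets borel})"
  proof (rule measurable_measure_of)
    fix A assume "A \<in> {f -` B | (f :: 'b \<Rightarrow> real) B. continuous_on UNIV f \<and> B \<in> sets borel}"
    then obtain f B where A: "A = f -` B" and f: "continuous_on UNIV (f :: 'b \<Rightarrow> real)"
      and B: "B \<in> sets borel" by blast
    have "continuous_on UNIV (f \<circ> \<psi>)"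
      using assms f by (intro continuous_on_compose) (auto intro: continuous_on_subset)
    then have "f \<circ> \<psi> \<in> borel_measurable baire"
      by (rule continuous_imp_borel_measurable_baire)
    from measurable_sets[OF this B] show "\<psi> -` A \<inter> space baire \<in> sets baire"
      by (simp add: A vimage_comp)
  qed auto
  then show ?thesis unfolding baire_def[where 'a = 'b] .
qed

lemma functionally_closed_imp_closed: "functionally_closed A \<Longrightarrow> closed A"
  unfolding functionally_closed_def by (auto intro: closed_vimage)

lemma topologically_consistent_imp_open_Union:
  assumes "topologically_consistent \<S>"
  shows "open (\<Union>\<S>)"
proof (subst open_subopen, intro ballI)
  fix x assume "x \<in> \<Union>\<S>"
  then obtain V where V: "V \<in> \<S>" "functionally_open V" "x \<in> V"
    using assms unfolding topologically_consistent_def by blast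
  have "open V"
    using V(2) functionally_closed_imp_closed unfolding functionally_open_def
    by (metis open_closed)
  with V show "\<exists>V. open V \<and> x \<in> V \<and> V \<subseteq> \<Union>\<S>" by blast
qed

lemma scaling_measurable:
  assumes "scaling T" and "t > 0"
  shows "T t \<in> measurable baire baire"
proof -
  have "(\<lambda>(x, t). T t x) \<in> measurable (baire \<Otimes>\<^sub>M restrict_space borel {0<..}) baire"
    using assms(1) unfolding scaling_def by blast
  moreover have "(\<lambda>x. (x, t)) \<in> measurable baire (baire \<Otimes>\<^sub>M restrict_space borel {0<..})"
    using assms(2) by (intro measurable_Pair measurable_ident_sets measurable_const)
      (auto simp: space_restrict_space)
  ultimately have "(\<lambda>x. case (x, t) of (x, t) \<Rightarrow> T t x) \<in> measurable baire baire"
    by (rule measurable_compose[rotated])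
  then show ?thesis by simp
qed

text \<open>
  The closed support of \<open>f\<close> lies in the open set \<open>\<Union>\<S>\<close>, so \<open>\<Union>\<S>\<close> and the complement of the support
  form an open cover; \<open>f\<close> is continuous on the former and zero on the latter.
\<close>
lemma C_ideal_imp_continuous:
  assumes "topologically_consistent \<S>" and f: "f \<in> C_ideal \<S>"
  shows "continuous_on UNIV f"
proof -
  let ?K = "closure {x. f x \<noteq> 0}"
  have K: "?K \<in> \<S>" using f by (simp add: C_ideal_def)
  have "0 = f x" if "x \<in> - ?K" for x
    using that closure_subset[of "{x. f x \<noteq> 0}"] by auto
  then have "continuous_on (- ?K) f"
    by (rule continuous_on_eq[OF continuous_on_const])
  then have "continuous_on (\<Union>\<S> \<union> - ?K) f"
    using f topologically_consistent_imp_open_Union[OF assms(1)]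
    by (intro continuous_on_open_Un) (auto simp: C_ideal_def)
  moreover have "\<Union>\<S> \<union> - ?K = UNIV" using K by blast
  ultimately show ?thesis by simp
qed

lemma C_ideal_compose:
  assumes \<X>: "ideal \<X>" and Y: "topologically_consistent \<Y>"
    and \<psi>: "continuous_on UNIV \<psi>" and born: "\<And>B. B \<in> \<Y> \<Longrightarrow> \<psi> -` B \<in> \<X>"
    and f: "f \<in> C_ideal \<Y>"
  shows "(\<lambda>x. f (\<psi> x)) \<in> C_ideal \<X>"
proof -
  let ?K = "closure {y. f y \<noteq> 0}"
  have K: "?K \<in> \<Y>" and f0: "\<And>y. y \<notin> \<Union>\<Y> \<Longrightarrow> f y = 0"
    using f by (auto simp: C_ideal_def)
  have "continuous_on UNIV f" by (rule C_ideal_imp_continuous[OF Y f])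
  then have "continuous_on UNIV (f \<circ> \<psi>)"
    using \<psi> by (intro continuous_on_compose) (auto intro: continuous_on_subset)
  then have cont: "continuous_on (\<Union>\<X>) (\<lambda>x. f (\<psi> x))"
    by (auto intro: continuous_on_subset simp: o_def)
  have "bounded (insert 0 (f ` \<Union>\<Y>))"
    using f by (simp add: C_ideal_def)
  moreover have "(\<lambda>x. f (\<psi> x)) ` \<Union>\<X> \<subseteq> insert 0 (f ` \<Union>\<Y>)"
    using f0 by blast
  ultimately have bdd: "bounded ((\<lambda>x. f (\<psi> x)) ` \<Union>\<X>)"
    by (rule bounded_subset)
  have zero: "f (\<psi> x) = 0" if "x \<notin> \<Union>\<X>" for x
    using that born f0 by blast
  have "closed (\<psi> -` ?K)" using \<psi> by (intro closed_vimage) auto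
  moreover have "{x. f (\<psi> x) \<noteq> 0} \<subseteq> \<psi> -` ?K"
    using closure_subset[of "{y. f y \<noteq> 0}"] by auto
  ultimately have "closure {x. f (\<psi> x) \<noteq> 0} \<subseteq> \<psi> -` ?K"
    by (rule closure_minimal[rotated])
  then have "closure {x. f (\<psi> x) \<noteq> 0} \<in> \<X>"
    using born[OF K] \<X> unfolding ideal_def by blast
  with cont bdd zero show ?thesis by (simp add: C_ideal_def)
qed

text \<open>
  Both integrals live on the Baire set \<open>{f \<noteq> 0} \<subseteq> \<Union>\<S>\<close>, where the two measures agree. Comparing the
  measures restricted to this set covers the non-integrable case as well.
\<close>
lemma integral_restrict_to_ideal:
  fixes \<mu> :: "'a::topological_space measure" and f :: "'a \<Rightarrow> real"
  assumes \<mu>: "baire_measure \<mu>" and f: "f \<in> borel_measurable baire"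
    and f0: "\<And>x. x \<notin> \<Union>\<S> \<Longrightarrow> f x = 0"
  shows "(\<integral>x. f x \<partial>restrict_to_ideal \<S> \<mu>) = (\<integral>x. f x \<partial>\<mu>)"
proof -
  define N where "N = {x. f x \<noteq> 0}"
  have s: "sets \<mu> = sets baire" using \<mu> by (simp add: baire_measure_def)
  have "f -` (- {0}) \<inter> space baire \<in> sets baire"
    by (rule measurable_sets[OF f]) simp
  moreover have "f -` (- {0}) = N" by (auto simp: N_def)
  ultimately have N: "N \<in> sets baire" by simp
  have NS: "N \<subseteq> \<Union>\<S>" using f0 by (auto simp: N_def)
  have on_N: "(\<integral>x. f x \<partial>m) = (\<integral>x. f x \<partial>restrict_space m N)"
    if m: "sets m = sets baire" for m :: "'a measure"
  proof -
    have "space m = UNIV" using sets_eq_imp_space_eq[OF m] by simp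
    then have "(\<integral>x. f x \<partial>restrict_space m N) = (\<integral>x. indicator N x *\<^sub>R f x \<partial>m)"
      using N m by (intro integral_restrict_space) simp
    also have "\<dots> = (\<integral>x. f x \<partial>m)"
      by (intro Bochner_Integration.integral_cong) (auto simp: N_def indicator_def)
    finally show ?thesis by simp
  qed
  have "restrict_space (restrict_to_ideal \<S> \<mu>) N = restrict_space \<mu> N"
  proof (rule measure_eqI)
    show "sets (restrict_space (restrict_to_ideal \<S> \<mu>) N) = sets (restrict_space \<mu> N)"
      by (simp add: sets_restrict_space s)
    fix A assume "A \<in> sets (restrict_space (restrict_to_ideal \<S> \<mu>) N)"
    then have A: "A \<in> sets baire" "A \<subseteq> N"
      using N by (auto simp: sets_restrict_space)
    have "emeasure (restrict_space m N) A = emeasure m A"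
      if m: "sets m = sets baire" for m :: "'a measure"
    proof -
      have "space m = UNIV" using sets_eq_imp_space_eq[OF m] by simp
      then show ?thesis using N A m by (intro emeasure_restrict_space) auto
    qed
    then show "emeasure (restrict_space (restrict_to_ideal \<S> \<mu>) N) A
        = emeasure (restrict_space \<mu> N) A"
      using emeasure_restrict_to_ideal_subset[OF \<mu> A(1)] A(2) NS s by auto
  qed
  then show ?thesis by (simp add: on_N s)
qed

lemma restrict_to_ideal_in_M_sigma:
  assumes \<mu>: "baire_measure \<mu>"
    and fin: "\<And>B. B \<in> \<S> \<Longrightarrow> B \<in> sets baire \<Longrightarrow> emeasure \<mu> B < \<infinity>"
  shows "restrict_to_ideal \<S> \<mu> \<in> M_sigma \<S>"
  unfolding M_sigma_def
proof (intro CollectI conjI ballI allI impI)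
  show "baire_measure (restrict_to_ideal \<S> \<mu>)" by (simp add: baire_measure_def)
next
  fix B assume B: "B \<in> \<S> \<inter> sets baire"
  then have "emeasure (restrict_to_ideal \<S> \<mu>) B = emeasure \<mu> B"
    by (intro emeasure_restrict_to_ideal_subset[OF \<mu>]) auto
  then show "emeasure (restrict_to_ideal \<S> \<mu>) B < \<infinity>" using fin B by simp
next
  fix A assume A: "A \<in> sets baire" "A \<subseteq> - \<Union>\<S>"
  have "emeasure \<mu> (A \<inter> C) = 0" if "C \<subseteq> \<Union>\<S>" for C
  proof -
    have "A \<inter> C = {}" using A(2) that by blast
    then show ?thesis by simp
  qed
  then show "emeasure (restrict_to_ideal \<S> \<mu>) A = 0"
    unfolding emeasure_restrict_to_ideal[OF \<mu> A(1)]
    by (intro antisym SUP_least) auto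
qed

theorem theorem3p3p2:
  fixes TX :: "real \<Rightarrow> 'a::topological_space \<Rightarrow> 'a"
    and TY :: "real \<Rightarrow> 'b::topological_space \<Rightarrow> 'b"
    and \<X> :: "'a set set" and \<Y> :: "'b set set"
    and \<psi> :: "'a \<Rightarrow> 'b" and g :: "real \<Rightarrow> real"
    and \<nu> \<mu> :: "'a measure"
  assumes "scaling TX" and "scaling TY"
    and "ideal \<X>" and "topologically_consistent \<X>" and "scaling_consistent TX \<X>"
    and "ideal \<Y>" and "topologically_consistent \<Y>" and "scaling_consistent TY \<Y>"
    and "continuous_on UNIV \<psi>"
    and "bornologically_consistent_morphism TX \<X> TY \<Y> \<psi>"
    and "baire_measure \<nu>" and "\<nu> \<in> RV TX \<X> g \<mu>"
    and "\<exists>B \<in> \<Y> \<inter> sets baire. 0 < emeasure (distr \<mu> baire \<psi>) B \<and> emeasure (distr \<mu> baire \<psi>) B < \<infinity>"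
  shows "distr \<nu> baire \<psi> \<in> RV TY \<Y> g (restrict_to_ideal \<Y> (distr \<mu> baire \<psi>))"
proof -
  let ?m = "distr \<mu> baire \<psi>"
  note X = assms(3) and Y = assms(7) and \<psi> = assms(9)
  have born: "\<And>B. B \<in> \<Y> \<Longrightarrow> \<psi> -` B \<in> \<X>"
    and equi: "\<And>x t. t > 0 \<Longrightarrow> \<psi> (TX t x) = TY t (\<psi> x)"
    using assms(10) by (auto simp: bornologically_consistent_morphism_def)
  have g: "g \<in> borel_measurable (restrict_space borel {0..})" "\<forall>t\<ge>0. g t \<ge> 0"
      "filterlim g at_top at_top"
    and \<mu>: "\<mu> \<in> M_sigma \<X>"
    and test: "\<And>f. f \<in> C_ideal \<X> \<Longrightarrow>
      (\<forall>\<^sub>F t in at_top. integrable \<nu> (\<lambda>x. f (TX (inverse t) x))) \<and>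
      ((\<lambda>t. g t * (\<integral>x. f (TX (inverse t) x) \<partial>\<nu>)) \<longlongrightarrow> (\<integral>x. f x \<partial>\<mu>)) at_top"
    using assms(12) by (auto simp: RV_def)
  have s\<mu>: "sets \<mu> = sets baire" and s\<nu>: "sets \<nu> = sets baire"
    using \<mu> assms(11) by (auto simp: M_sigma_def baire_measure_def)
  have \<psi>b: "\<psi> \<in> measurable baire baire"
    by (rule continuous_imp_measurable_baire[OF \<psi>])
  have \<psi>\<mu>: "\<psi> \<in> measurable \<mu> baire" and \<psi>\<nu>: "\<psi> \<in> measurable \<nu> baire"
    using \<psi>b by (simp_all add: measurable_cong_sets[OF s\<mu> refl] measurable_cong_sets[OF s\<nu> refl])
  have m: "baire_measure ?m" by (simp add: baire_measure_def)
  have fin: "emeasure ?m B < \<infinity>" if B: "B \<in> \<Y>" "B \<in> sets baire" for B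
  proof -
    have "\<psi> -` B \<in> \<X> \<inter> sets baire"
      using born[OF B(1)] measurable_sets[OF \<psi>b B(2)] by simp
    moreover have "emeasure ?m B = emeasure \<mu> (\<psi> -` B)"
      using emeasure_distr[OF \<psi>\<mu> B(2)] sets_eq_imp_space_eq[OF s\<mu>] by simp
    ultimately show ?thesis using \<mu> by (simp add: M_sigma_def)
  qed
  obtain B where B: "B \<in> \<Y>" "B \<in> sets baire" "0 < emeasure ?m B"
    using assms(13) by blast
  have "emeasure (restrict_to_ideal \<Y> ?m) B = emeasure ?m B"
    using B by (intro emeasure_restrict_to_ideal_subset[OF m]) auto
  with B have nontrivial: "\<exists>B \<in> \<Y> \<inter> sets baire. 0 < emeasure (restrict_to_ideal \<Y> ?m) B"
    by (intro bexI[of _ B]) simp_all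
  have vague: "(\<forall>\<^sub>F t in at_top. integrable (distr \<nu> baire \<psi>) (\<lambda>y. f (TY (inverse t) y))) \<and>
      ((\<lambda>t. g t * (\<integral>y. f (TY (inverse t) y) \<partial>distr \<nu> baire \<psi>)) \<longlongrightarrow>
        (\<integral>y. f y \<partial>restrict_to_ideal \<Y> ?m)) at_top"
    if f: "f \<in> C_ideal \<Y>" for f
  proof -
    have fb: "f \<in> borel_measurable baire"
      by (intro continuous_imp_borel_measurable_baire C_ideal_imp_continuous[OF Y f])
    have lim: "(\<integral>y. f y \<partial>restrict_to_ideal \<Y> ?m) = (\<integral>x. f (\<psi> x) \<partial>\<mu>)"
      using f by (subst integral_restrict_to_ideal[OF m fb])
        (auto simp: C_ideal_def integral_distr[OF \<psi>\<mu> fb])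
    have fT: "(\<lambda>y. f (TY (inverse t) y)) \<in> borel_measurable baire" if "t > 0" for t
      using that by (intro measurable_compose[OF scaling_measurable[OF assms(2)] fb]) simp
    have int: "integrable (distr \<nu> baire \<psi>) (\<lambda>y. f (TY (inverse t) y)) \<longleftrightarrow>
          integrable \<nu> (\<lambda>x. f (\<psi> (TX (inverse t) x)))"
      and eq: "(\<integral>y. f (TY (inverse t) y) \<partial>distr \<nu> baire \<psi>) =
          (\<integral>x. f (\<psi> (TX (inverse t) x)) \<partial>\<nu>)" if "t > 0" for t
      using that by (simp_all add: equi integrable_distr_eq[OF \<psi>\<nu> fT] integral_distr[OF \<psi>\<nu> fT])
    have "(\<lambda>x. f (\<psi> x)) \<in> C_ideal \<X>"
      by (rule C_ideal_compose[OF X Y \<psi> _ f]) (rule born)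
    note hyp = test[OF this]
    have "\<forall>\<^sub>F t in at_top. integrable (distr \<nu> baire \<psi>) (\<lambda>y. f (TY (inverse t) y))"
      using conjunct1[OF hyp] eventually_gt_at_top[of 0]
      by eventually_elim (simp add: int)
    moreover have "\<forall>\<^sub>F t in at_top. g t * (\<integral>x. f (\<psi> (TX (inverse t) x)) \<partial>\<nu>) =
        g t * (\<integral>y. f (TY (inverse t) y) \<partial>distr \<nu> baire \<psi>)"
      using eventually_gt_at_top[of 0] by eventually_elim (simp add: eq)
    ultimately show ?thesis
      unfolding lim by (blast intro: Lim_transform_eventually[OF conjunct2[OF hyp]])
  qed
  have "baire_measure (distr \<nu> baire \<psi>)" by (simp add: baire_measure_def)
  moreover have "restrict_to_ideal \<Y> ?m \<in> M_sigma \<Y>"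
    by (rule restrict_to_ideal_in_M_sigma[OF m fin])
  ultimately show ?thesis
    unfolding RV_def using g nontrivial vague by (intro CollectI conjI ballI) blast+
qed

end
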